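(* Let $G$ be a compact Lie group. The deformed fermionic action $$S_{\mathrm{ferm}}^{(q)} = \int_{\mathcal M_{\mathrm{eff}}} d^{d_{\mathrm{eff}}}x\,\sqrt{|\det g_{\mathrm{eff}}|}\;\bar\psi\left(i\gamma^a D_a^{(q)} - m\right)\psi$$ is invariant under the gauge transformations $$\psi\to U\psi,\qquad \bar\psi\to\bar\psi U^{-1},\qquad D_a^{(q)}\to U D_a^{(q)} U^{-1},$$ where $U(x)\in G$ is an arbitrary local gauge transformation.
   Context: Let $g^{\mu\nu}=\operatorname{diag}(g^{00},g^{11},g^{22},g^{33})$ be a diagonal tensor, some of whose diagonal components may vanish. The effective non-degenerate sector $\mathcal M_{\mathrm{eff}}\subseteq\mathcal M$ of spacetime $\mathcal M$ is the submanifold spanned only by the coordinates with $g^{\mu\mu}\neq 0$; $d_{\mathrm{eff}}$ is the number of non-vanishing diagonal components; $g_{\mathrm{eff}}^{ab}$ is the restriction of $g^{\mu\nu}$ to $\mathcal M_{\mathrm{eff}}$ (a non-degenerate diagonal metric), with indices $a,b=0,\dots,d_{\mathrm{eff}}-1$ running over these coordinates only. The metric $g_{\mathrm{eff}}$ is a fixed background: it does not change under gauge transformations. The gauge field $A_a(x)$ takes values in the Lie algebra of $G$. With $h_a(x)=1/\sqrt{|g_{\mathrm{eff}}^{aa}(x)|}$ and $e$ a constant, the deformed covariant derivative is the operator $D_a^{(q)}=\partial_a+ie\,h_aA_a$ (no sum over $a$). The fermion field $\psi$ takes values in $S\otimes V$, with $S$ the spinor space and $V$ the fundamental representation of $G$,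 and $\bar\psi$ is its Dirac conjugate, with values in the dual space. The matrices $\gamma^a$ are (constant) gamma matrices associated with the effective sector and act on $S$, while $U(x)$ and $A_a(x)$ act on $V$. The constant $m$ is the mass. In the action, the index $a$ in $\gamma^aD_a^{(q)}$ is summed. All fields and $U$ are smooth. *)

theory Defs
  imports "HOL-Analysis.Analysis" "HOL-Algebra.Group"
begin

text \<open>Smoothness of a map on a set that is open in a translate of a linear subspace \<open>W\<close>: directional
  derivatives of all orders along \<open>W\<close> exist and are continuous. Only the values of the map on \<open>S\<close>
  matter.\<close>

definition open_along :: "'a::real_normed_vector set \<Rightarrow> 'a set \<Rightarrow> bool" where
  "open_along W S \<longleftrightarrow> (\<exists>c. openin (top_of_set ((\<lambda>w. c + w) ` W)) S)"

primrec Ck_on :: "nat \<Rightarrow> 'a::real_normed_vector set \<Rightarrow> 'a set \<Rightarrow> ('a \<Rightarrow> 'b::real_normed_vector) \<Rightarrow> bool"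
  where
    "Ck_on 0 W S f \<longleftrightarrow> continuous_on S f"
  | "Ck_on (Suc k) W S f \<longleftrightarrow> continuous_on S f \<and>
      (\<forall>w\<in>W. \<exists>f'. (\<forall>x\<in>S. ((\<lambda>t. f (x + t *\<^sub>R w)) has_vector_derivative f' x) (at 0)) \<and> Ck_on k W S f')"

definition smooth_along :: "'a::real_normed_vector set \<Rightarrow> 'a set \<Rightarrow> ('a \<Rightarrow> 'b::real_normed_vector) \<Rightarrow> bool"
  where "smooth_along W S f \<longleftrightarrow> (\<forall>k. Ck_on k W S f)"

text \<open>A manifold is given by its topology, the linear space \<open>model\<close> it is modelled on (a subspace of
  the type \<open>'e\<close>, so that every dimension, zero included, can occur) and an atlas of pairs of a chart
  domain and a chart.\<close>

record ('p, 'e) manifold =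
  mtop :: "'p topology"
  model :: "'e set"
  charts :: "('p set \<times> ('p \<Rightarrow> 'e)) set"

definition smooth_manifold :: "('p, 'e::euclidean_space) manifold \<Rightarrow> bool" where
  "smooth_manifold N \<longleftrightarrow>
     Hausdorff_space (mtop N) \<and> second_countable (mtop N) \<and> subspace (model N) \<and>
     \<Union>(fst ` charts N) = topspace (mtop N) \<and>
     (\<forall>(D, \<phi>)\<in>charts N. openin (mtop N) D \<and> open_along (model N) (\<phi> ` D) \<and>
        homeomorphic_map (subtopology (mtop N) D) (top_of_set (\<phi> ` D)) \<phi>) \<and>
     (\<forall>(D, \<phi>)\<in>charts N. \<forall>(D', \<phi>')\<in>charts N.
        smooth_along (model N) (\<phi> ` (D \<inter> D')) (\<phi>' \<circ> inv_into D \<phi>))"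

definition smooth_map ::
  "('p, 'e::real_normed_vector) manifold \<Rightarrow> ('q, 'f::real_normed_vector) manifold \<Rightarrow> ('p \<Rightarrow> 'q) \<Rightarrow> bool" where
  "smooth_map N P f \<longleftrightarrow> continuous_map (mtop N) (mtop P) f \<and>
     (\<forall>(D, \<phi>)\<in>charts N. \<forall>(D', \<phi>')\<in>charts P.
        smooth_along (model N) (\<phi> ` {x\<in>D. f x \<in> D'}) (\<phi>' \<circ> f \<circ> inv_into D \<phi>))"

definition prod_manifold ::
  "('p, 'e) manifold \<Rightarrow> ('q, 'f) manifold \<Rightarrow> ('p \<times> 'q, 'e \<times> 'f) manifold" where
  "prod_manifold N P =
     \<lparr>mtop = prod_topology (mtop N) (mtop P), model = model N \<times> model P,
      charts = {(D \<times> D', map_prod \<phi> \<phi>') | D \<phi> D' \<phi>'. (D, \<phi>) \<in> charts N \<and> (D', \<phi>') \<in> charts P}\<rparr>"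

definition region :: "'e::real_normed_vector set \<Rightarrow> 'e set \<Rightarrow> ('e, 'e) manifold" where
  "region W S = \<lparr>mtop = top_of_set S, model = W, charts = {(S, id)}\<rparr>"

definition lie_group :: "('g, 'z) monoid_scheme \<Rightarrow> ('g, 'e::euclidean_space) manifold \<Rightarrow> bool" where
  "lie_group G \<G> \<longleftrightarrow> group G \<and> smooth_manifold \<G> \<and> topspace (mtop \<G>) = carrier G \<and>
     smooth_map (prod_manifold \<G> \<G>) \<G> (\<lambda>(x, y). x \<otimes>\<^bsub>G\<^esub> y) \<and>
     smooth_map \<G> \<G> (\<lambda>x. inv\<^bsub>G\<^esub> x)"

definition compact_lie_group :: "('g, 'z) monoid_scheme \<Rightarrow> ('g, 'e::euclidean_space) manifold \<Rightarrow> bool" where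
  "compact_lie_group G \<G> \<longleftrightarrow> lie_group G \<G> \<and> compact_space (mtop \<G>)"

text \<open>A smooth representation on the complex vector space with a basis indexed by \<open>'n\<close>.\<close>

definition lie_representation ::
  "('g, 'z) monoid_scheme \<Rightarrow> ('g, 'e::euclidean_space) manifold \<Rightarrow> ('g \<Rightarrow> complex^'n^'n) \<Rightarrow> bool" where
  "lie_representation G \<G> \<rho> \<longleftrightarrow> smooth_map \<G> (region UNIV UNIV) \<rho> \<and> \<rho> \<one>\<^bsub>G\<^esub> = mat 1 \<and>
     (\<forall>x\<in>carrier G. \<forall>y\<in>carrier G. \<rho> (x \<otimes>\<^bsub>G\<^esub> y) = \<rho> x ** \<rho> y)"

text \<open>The Lie algebra of \<open>G\<close> as it acts on the representation space: the velocities at the identity of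
  smooth curves in \<open>G\<close>. Since the covariant derivative is \<open>\<partial> + i e h A\<close>, a gauge field follows the
  physicists' convention: \<open>i A\<close>, and not \<open>A\<close>, is a velocity.\<close>

definition lie_algebra_action ::
  "('g, 'z) monoid_scheme \<Rightarrow> ('g, 'e::euclidean_space) manifold \<Rightarrow> ('g \<Rightarrow> complex^'n^'n) \<Rightarrow> (complex^'n^'n) set"
  where
  "lie_algebra_action G \<G> \<rho> =
     {X. \<exists>c. smooth_map (region (UNIV :: real set) UNIV) \<G> c \<and> c 0 = \<one>\<^bsub>G\<^esub> \<and>
             ((\<lambda>t. \<rho> (c t)) has_vector_derivative X) (at 0)}"

definition cscale :: "complex \<Rightarrow> complex^'n^'m \<Rightarrow> complex^'n^'m" where
  "cscale c X = (\<chi> i j. c * X $ i $ j)"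

definition hermitian_transpose :: "complex^'n^'m \<Rightarrow> complex^'m^'n" where
  "hermitian_transpose X = (\<chi> i j. cnj (X $ j $ i))"

definition gauge_field_values ::
  "('g, 'z) monoid_scheme \<Rightarrow> ('g, 'e::euclidean_space) manifold \<Rightarrow> ('g \<Rightarrow> complex^'n^'n) \<Rightarrow> (complex^'n^'n) set"
  where "gauge_field_values G \<G> \<rho> = {X. cscale \<i> X \<in> lie_algebra_action G \<G> \<rho>}"

text \<open>\<open>\<kappa>\<close> is the Gram matrix of a \<open>G\<close>-invariant Hermitian inner product, conjugate linear in the first
  argument. The Dirac conjugate uses it to map the representation space to its dual; for a unitary
  matrix group one takes \<open>\<kappa> = mat 1\<close>.\<close>

definition invariant_inner_product ::
  "('g, 'z) monoid_scheme \<Rightarrow> ('g \<Rightarrow> complex^'n^'n) \<Rightarrow> complex^'n^'n \<Rightarrow> bool" where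
  "invariant_inner_product G \<rho> \<kappa> \<longleftrightarrow> hermitian_transpose \<kappa> = \<kappa> \<and>
     (\<forall>v. v \<noteq> 0 \<longrightarrow> Re (\<Sum>i\<in>UNIV. \<Sum>j\<in>UNIV. cnj (v $ i) * \<kappa> $ i $ j * v $ j) > 0) \<and>
     (\<forall>x\<in>carrier G. hermitian_transpose (\<rho> x) ** \<kappa> ** \<rho> x = \<kappa>)"

text \<open>Spacetime \<open>M\<close> is a coordinate domain and \<open>g x\<close> is the contravariant tensor at \<open>x\<close>. The set of
  indices with a vanishing diagonal component does not depend on the point.\<close>

definition diagonal_tensor :: "(real^4) set \<Rightarrow> (real^4 \<Rightarrow> real^4^4) \<Rightarrow> bool" where
  "diagonal_tensor M g \<longleftrightarrow> smooth_along UNIV M g \<and>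
     (\<forall>x\<in>M. \<forall>\<mu> \<nu>. \<mu> \<noteq> \<nu> \<longrightarrow> g x $ \<mu> $ \<nu> = 0) \<and>
     (\<forall>\<mu>. (\<forall>x\<in>M. g x $ \<mu> $ \<mu> = 0) \<or> (\<forall>x\<in>M. g x $ \<mu> $ \<mu> \<noteq> 0))"

definition eff_indices :: "(real^4) set \<Rightarrow> (real^4 \<Rightarrow> real^4^4) \<Rightarrow> 4 set" where
  "eff_indices M g = {\<mu>. \<exists>x\<in>M. g x $ \<mu> $ \<mu> \<noteq> 0}"

definition coord_dir :: "4 \<Rightarrow> real^4" where
  "coord_dir a = axis a 1"

text \<open>The effective sector is the coordinate slice of \<open>M\<close> through a base point \<open>p\<close>. Fields on it are
  functions on \<open>real^4\<close> of which only the restriction to the slice matters, and the indices \<open>a, b\<close> of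
  the sector run over \<open>E = eff_indices M g\<close>, so \<open>d\<^sub>e\<^sub>f\<^sub>f = card E\<close>.\<close>

definition eff_directions :: "4 set \<Rightarrow> (real^4) set" where
  "eff_directions E = span (coord_dir ` E)"

definition eff_sector :: "(real^4) set \<Rightarrow> 4 set \<Rightarrow> real^4 \<Rightarrow> (real^4) set" where
  "eff_sector M E p = {x\<in>M. \<forall>\<mu>. \<mu> \<notin> E \<longrightarrow> x $ \<mu> = p $ \<mu>}"

text \<open>Lebesgue measure in the coordinates indexed by \<open>E\<close>, carried to the slice through \<open>p\<close>.\<close>

definition eff_lebesgue :: "4 set \<Rightarrow> real^4 \<Rightarrow> (real^4) measure" where
  "eff_lebesgue E p =
     distr (Pi\<^sub>M E (\<lambda>_. lborel)) borel (\<lambda>y. \<chi> \<mu>. if \<mu> \<in> E then y \<mu> else p $ \<mu>)"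

text \<open>The block of \<open>g\<close> with indices in \<open>E\<close>, completed by the identity block on the other indices; this
  changes neither the determinant nor the entries of the inverse with indices in \<open>E\<close>. The metric
  \<open>g\<^sub>e\<^sub>f\<^sub>f\<close> in the volume density has lower indices: it is the inverse of the contravariant block.\<close>

definition eff_inverse_metric :: "4 set \<Rightarrow> (real^4 \<Rightarrow> real^4^4) \<Rightarrow> real^4 \<Rightarrow> real^4^4" where
  "eff_inverse_metric E g x =
     (\<chi> a b. if a \<in> E \<and> b \<in> E then g x $ a $ b else if a = b then 1 else 0)"

definition eff_metric :: "4 set \<Rightarrow> (real^4 \<Rightarrow> real^4^4) \<Rightarrow> real^4 \<Rightarrow> real^4^4" where
  "eff_metric E g x = matrix_inv (eff_inverse_metric E g x)"

definition volume_density :: "4 set \<Rightarrow> (real^4 \<Rightarrow> real^4^4) \<Rightarrow> real^4 \<Rightarrow> real" where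
  "volume_density E g x = sqrt \<bar>det (eff_metric E g x)\<bar>"

definition deformation_factor :: "(real^4 \<Rightarrow> real^4^4) \<Rightarrow> 4 \<Rightarrow> real^4 \<Rightarrow> real" where
  "deformation_factor g a x = 1 / sqrt \<bar>g x $ a $ a\<bar>"

text \<open>Constant gamma matrices for the signature of the effective metric:
  \<open>\<gamma>\<^sup>a \<gamma>\<^sup>b + \<gamma>\<^sup>b \<gamma>\<^sup>a = 2 \<eta>\<^sup>a\<^sup>b\<close>, where \<open>\<eta>\<close> is the diagonal matrix of the signs of the components of
  \<open>g\<close>.\<close>

definition gamma_matrices ::
  "4 set \<Rightarrow> (real^4) set \<Rightarrow> (real^4 \<Rightarrow> real^4^4) \<Rightarrow> (4 \<Rightarrow> complex^'s^'s) \<Rightarrow> bool" where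
  "gamma_matrices E S g \<gamma> \<longleftrightarrow> (\<forall>a\<in>E. \<forall>b\<in>E. \<forall>x\<in>S.
     \<gamma> a ** \<gamma> b + \<gamma> b ** \<gamma> a = cscale (complex_of_real (2 * sgn (g x $ a $ b))) (mat 1))"

text \<open>\<open>\<beta>\<close> is the matrix of a nondegenerate sesquilinear form on spinors for which each gamma matrix is
  self-adjoint or skew-adjoint. In the usual representations, in which every \<open>\<gamma>\<^sup>a\<close> is Hermitian or
  anti-Hermitian, \<open>\<beta> = \<gamma>\<^sup>0\<close> is such a matrix and gives \<open>\<psi>\<^sup>\<dagger>\<gamma>\<^sup>0\<close>. A general \<open>\<beta>\<close> is needed because
  the index 0 need not belong to the effective sector.\<close>

definition dirac_form :: "4 set \<Rightarrow> (4 \<Rightarrow> complex^'s^'s) \<Rightarrow> complex^'s^'s \<Rightarrow> bool" where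
  "dirac_form E \<gamma> \<beta> \<longleftrightarrow> invertible \<beta> \<and>
     (\<forall>a\<in>E. \<exists>\<epsilon>\<in>{1, -1}. hermitian_transpose (\<gamma> a) ** \<beta> = cscale \<epsilon> (\<beta> ** \<gamma> a))"

text \<open>An element of \<open>S \<otimes> V\<close> is a matrix whose row index is the spinor index and whose column index is
  the gauge index. A spinor matrix \<open>\<gamma>\<close> then acts as \<open>\<gamma> ** \<psi>\<close> and a matrix \<open>T\<close> on \<open>V\<close> acts by
  \<open>\<psi>\<^sub>s\<^sub>i \<mapsto> \<Sum>\<^sub>j T\<^sub>i\<^sub>j \<psi>\<^sub>s\<^sub>j\<close>. An element of the dual space has the gauge index first; \<open>T\<close> acts on it from
  the right, by \<open>\<xi>\<^sub>i\<^sub>s \<mapsto> \<Sum>\<^sub>j \<xi>\<^sub>j\<^sub>s T\<^sub>j\<^sub>i\<close>.\<close>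

definition gauge_act :: "complex^'n^'n \<Rightarrow> complex^'n^'s \<Rightarrow> complex^'n^'s" where
  "gauge_act T \<psi> = \<psi> ** transpose T"

definition gauge_act_dual :: "complex^'s^'n \<Rightarrow> complex^'n^'n \<Rightarrow> complex^'s^'n" where
  "gauge_act_dual \<xi> T = transpose T ** \<xi>"

definition dual_pairing :: "complex^'s^'n \<Rightarrow> complex^'n^'s \<Rightarrow> complex" where
  "dual_pairing \<xi> \<psi> = (\<Sum>i\<in>UNIV. \<Sum>s\<in>UNIV. \<xi> $ i $ s * \<psi> $ s $ i)"

text \<open>The components are \<open>\<Sum>\<^sub>t\<^sub>j cnj \<psi>\<^sub>t\<^sub>j \<beta>\<^sub>t\<^sub>s \<kappa>\<^sub>j\<^sub>i\<close>.\<close>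

definition dirac_conjugate :: "complex^'s^'s \<Rightarrow> complex^'n^'n \<Rightarrow> complex^'n^'s \<Rightarrow> complex^'s^'n" where
  "dirac_conjugate \<beta> \<kappa> \<psi> = transpose \<kappa> ** hermitian_transpose \<psi> ** \<beta>"

type_synonym ('s, 'n) fermion = "real^4 \<Rightarrow> complex^'n^'s"
type_synonym ('s, 'n) dual_fermion = "real^4 \<Rightarrow> complex^'s^'n"

definition partial_deriv :: "4 \<Rightarrow> ('s::finite, 'n::finite) fermion \<Rightarrow> ('s, 'n) fermion" where
  "partial_deriv a \<psi> x = vector_derivative (\<lambda>t. \<psi> (x + t *\<^sub>R coord_dir a)) (at 0)"

definition deformed_covariant_derivative ::
  "real \<Rightarrow> (real^4 \<Rightarrow> real^4^4) \<Rightarrow> (4 \<Rightarrow> real^4 \<Rightarrow> complex^'n^'n) \<Rightarrow>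
     4 \<Rightarrow> ('s::finite, 'n::finite) fermion \<Rightarrow> ('s, 'n) fermion" where
  "deformed_covariant_derivative e g A a \<psi> x =
     partial_deriv a \<psi> x +
     cscale (\<i> * complex_of_real (e * deformation_factor g a x)) (gauge_act (A a x) (\<psi> x))"

text \<open>The action takes the family of operators \<open>D\<^sub>a\<close> as an argument, so that it can be evaluated at the
  conjugated operators as well. \<open>M\<^sub>e\<^sub>f\<^sub>f\<close> is the effective sector through \<open>p\<close>.\<close>

definition fermionic_action ::
  "(real^4) set \<Rightarrow> (real^4 \<Rightarrow> real^4^4) \<Rightarrow> real^4 \<Rightarrow> (4 \<Rightarrow> complex^'s^'s) \<Rightarrow> real \<Rightarrow>
     (4 \<Rightarrow> ('s::finite, 'n::finite) fermion \<Rightarrow> ('s, 'n) fermion) \<Rightarrow>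
     ('s, 'n) dual_fermion \<Rightarrow> ('s, 'n) fermion \<Rightarrow> complex" where
  "fermionic_action M g p \<gamma> m D \<psi>bar \<psi> =
     (let E = eff_indices M g in
      set_lebesgue_integral (eff_lebesgue E p) (eff_sector M E p)
        (\<lambda>x. complex_of_real (volume_density E g x) *
             dual_pairing (\<psi>bar x)
               ((\<Sum>a\<in>E. cscale \<i> (\<gamma> a ** D a \<psi> x)) - cscale (complex_of_real m) (\<psi> x))))"

definition gauge_fermion ::
  "(real^4 \<Rightarrow> complex^'n^'n) \<Rightarrow> ('s::finite, 'n::finite) fermion \<Rightarrow> ('s, 'n) fermion" where
  "gauge_fermion T \<psi> x = gauge_act (T x) (\<psi> x)"

definition gauge_dual_fermion ::
  "('s::finite, 'n::finite) dual_fermion \<Rightarrow> (real^4 \<Rightarrow> complex^'n^'n) \<Rightarrow> ('s, 'n) dual_fermion" where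
  "gauge_dual_fermion \<psi>bar T x = gauge_act_dual (\<psi>bar x) (T x)"

end

theory Submission
  imports Defs
begin

text \<open>The integrand is invariant pointwise. A point of the effective sector can be moved a little along
  each effective direction without leaving the sector, so there \<open>U\<^sup>-\<^sup>1 U \<psi>\<close> and \<open>\<psi>\<close> have the same germ
  along this direction and the conjugated operator sends \<open>U \<psi>\<close> to \<open>U D\<^sub>a \<psi>\<close>. Spinor matrices act on
  the other tensor factor and commute with \<open>U\<close>, and in the pairing of \<open>\<psi>bar U\<^sup>-\<^sup>1\<close> with \<open>U \<chi>\<close> the
  matrix \<open>U\<^sup>-\<^sup>1\<close> moves to the second argument and cancels \<open>U\<close>.\<close>

text \<open>Transposition and multiplication from the right each reverse the order, so together they
  give a left action.\<close>

lemma gauge_act_compose: "gauge_act S (gauge_act T \<psi>) = gauge_act (S ** T) \<psi>"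
  by (simp add: gauge_act_def matrix_transpose_mul matrix_mul_assoc)

lemma gauge_act_id [simp]: "gauge_act (mat 1) \<psi> = \<psi>"
  by (simp add: gauge_act_def)

lemma gauge_act_diff: "gauge_act T (\<psi> - \<phi>) = gauge_act T \<psi> - gauge_act T \<phi>"
  by (simp add: gauge_act_def matrix_matrix_mult_def vec_eq_iff left_diff_distrib sum_subtractf)

lemma gauge_act_sum: "gauge_act T (\<Sum>a\<in>E. f a) = (\<Sum>a\<in>E. gauge_act T (f a))"
proof (induction E rule: infinite_finite_induct)
  case (insert a E)
  then show ?case
    by (simp add: gauge_act_def matrix_matrix_mult_def vec_eq_iff distrib_right sum.distrib)
qed (simp_all add: gauge_act_def)

lemma gauge_act_cscale: "gauge_act T (cscale c \<psi>) = cscale c (gauge_act T \<psi>)"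
  by (simp add: gauge_act_def cscale_def matrix_matrix_mult_def vec_eq_iff sum_distrib_left mult.assoc)

text \<open>The two actions multiply the matrix \<psi> on opposite sides, so they commute by
  associativity.\<close>

lemma spinor_matrix_gauge_act: "\<gamma> ** gauge_act T \<psi> = gauge_act T (\<gamma> ** \<psi>)"
  by (simp add: gauge_act_def matrix_mul_assoc)

text \<open>Both sides are one triple sum over two gauge indices and a spinor index; three exchanges
  of adjacent sums take the order \<open>i, s, j\<close> to \<open>j, s, i\<close>.\<close>

lemma dual_pairing_gauge_act_dual:
  "dual_pairing (gauge_act_dual \<xi> T) \<psi> = dual_pairing \<xi> (gauge_act T \<psi>)"
proof -
  have "dual_pairing (gauge_act_dual \<xi> T) \<psi> =
      (\<Sum>i\<in>UNIV. \<Sum>s\<in>UNIV. \<Sum>j\<in>UNIV. T $ j $ i * \<xi> $ j $ s * \<psi> $ s $ i)"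
    by (simp add: dual_pairing_def gauge_act_dual_def matrix_matrix_mult_def transpose_def
        sum_distrib_right)
  also have "\<dots> = (\<Sum>i\<in>UNIV. \<Sum>j\<in>UNIV. \<Sum>s\<in>UNIV. T $ j $ i * \<xi> $ j $ s * \<psi> $ s $ i)"
    by (intro sum.cong refl sum.swap)
  also have "\<dots> = (\<Sum>j\<in>UNIV. \<Sum>i\<in>UNIV. \<Sum>s\<in>UNIV. T $ j $ i * \<xi> $ j $ s * \<psi> $ s $ i)"
    by (rule sum.swap)
  also have "\<dots> = (\<Sum>j\<in>UNIV. \<Sum>s\<in>UNIV. \<Sum>i\<in>UNIV. T $ j $ i * \<xi> $ j $ s * \<psi> $ s $ i)"
    by (intro sum.cong refl sum.swap)
  also have "\<dots> = dual_pairing \<xi> (gauge_act T \<psi>)"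
    by (simp add: dual_pairing_def gauge_act_def matrix_matrix_mult_def transpose_def
        sum_distrib_left mult_ac)
  finally show ?thesis .
qed

text \<open>Openness keeps nearby points in \<open>M\<close>, and a step along \<open>a\<close> in
  \<open>E\<close> leaves the coordinates outside \<open>E\<close> at their values in
  \<open>p\<close>. The filter is \<open>nhds 0\<close> because equality of germs includes the point
  0 itself.\<close>

lemma eventually_in_eff_sector:
  assumes "open M" "a \<in> E" "x \<in> eff_sector M E p"
  shows "\<forall>\<^sub>F t in nhds 0. x + t *\<^sub>R coord_dir a \<in> eff_sector M E p"
proof -
  have "((\<lambda>t. x + t *\<^sub>R coord_dir a) \<longlongrightarrow> x + 0 *\<^sub>R coord_dir a) (nhds (0::real))"
    by (intro tendsto_intros filterlim_ident)
  then have "\<forall>\<^sub>F t in nhds (0::real). x + t *\<^sub>R coord_dir a \<in> M"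
    using assms by (intro topological_tendstoD[of _ x]) (auto simp: eff_sector_def)
  then show ?thesis
    using assms by (auto elim!: eventually_mono simp: eff_sector_def coord_dir_def axis_def)
qed

text \<open>Fields are total functions on \<open>real^4\<close> with arbitrary values off the
  sector; this lemma shows that derivatives along effective directions do not see those
  values.\<close>

lemma partial_deriv_cong_eff_sector:
  assumes "open M" "a \<in> E" "x \<in> eff_sector M E p"
    and "\<And>y. y \<in> eff_sector M E p \<Longrightarrow> \<phi> y = \<psi> y"
  shows "partial_deriv a \<phi> x = partial_deriv a \<psi> x"
  unfolding partial_deriv_def
  using eventually_in_eff_sector[OF assms(1-3)] assms(4)
  by (intro vector_derivative_cong_eq) (auto elim!: eventually_mono)

lemma deformed_covariant_derivative_cong_eff_sector:
  assumes "open M" "a \<in> E" "x \<in> eff_sector M E p"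
    and "\<And>y. y \<in> eff_sector M E p \<Longrightarrow> \<phi> y = \<psi> y"
  shows "deformed_covariant_derivative e g A a \<phi> x = deformed_covariant_derivative e g A a \<psi> x"
  using partial_deriv_cong_eff_sector[OF assms] assms(3,4)
  by (simp add: deformed_covariant_derivative_def)

text \<open>The inverse is taken in the group, not among matrices; multiplicativity of \<rho>
  carries the group identity over.\<close>

lemma lie_representation_left_inverse:
  assumes "lie_group G \<G>" "lie_representation G \<G> \<rho>" "x \<in> carrier G"
  shows "\<rho> (inv\<^bsub>G\<^esub> x) ** \<rho> x = mat 1"
proof -
  interpret group G
    using assms(1) by (simp add: lie_group_def)
  show ?thesis
    using assms(2,3) unfolding lie_representation_def by (metis inv_closed l_inv)
qed

theorem proposition5p7:
  fixes G :: "('g, 'z) monoid_scheme"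
    and \<G> :: "('g, 'e::euclidean_space) manifold"
    and \<rho> :: "'g \<Rightarrow> complex^'n::finite^'n"
    and \<kappa> :: "complex^'n^'n"
    and M :: "(real^4) set" and p :: "real^4" and g :: "real^4 \<Rightarrow> real^4^4"
    and \<gamma> :: "4 \<Rightarrow> complex^'s::finite^'s" and \<beta> :: "complex^'s^'s"
    and e m :: real
    and A :: "4 \<Rightarrow> real^4 \<Rightarrow> complex^'n^'n"
    and \<psi> :: "('s, 'n) fermion"
    and U :: "real^4 \<Rightarrow> 'g"
  defines "E \<equiv> eff_indices M g"
    and "Meff \<equiv> eff_sector M (eff_indices M g) p"
    and "W \<equiv> eff_directions (eff_indices M g)"
    and "D \<equiv> deformed_covariant_derivative e g A"
    and "R \<equiv> \<lambda>x. \<rho> (U x)"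
    and "Rinv \<equiv> \<lambda>x. \<rho> (inv\<^bsub>G\<^esub> (U x))"
    and "\<psi>bar \<equiv> \<lambda>x. dirac_conjugate \<beta> \<kappa> (\<psi> x)"
  assumes "compact_lie_group G \<G>"
    and "lie_representation G \<G> \<rho>"
    and "invariant_inner_product G \<rho> \<kappa>"
    and "open M" and "p \<in> M" and "diagonal_tensor M g"
    and "gamma_matrices E Meff g \<gamma>"
    and "dirac_form E \<gamma> \<beta>"
    and "\<And>a. a \<in> E \<Longrightarrow> smooth_along W Meff (A a)"
    and "\<And>a x. a \<in> E \<Longrightarrow> x \<in> Meff \<Longrightarrow> A a x \<in> gauge_field_values G \<G> \<rho>"
    and "smooth_along W Meff \<psi>"
    and "smooth_map (region W Meff) \<G> U"
  shows "fermionic_action M g p \<gamma> m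
           (\<lambda>a \<phi>. gauge_fermion R (D a (gauge_fermion Rinv \<phi>)))
           (gauge_dual_fermion \<psi>bar Rinv)
           (gauge_fermion R \<psi>)
         = fermionic_action M g p \<gamma> m D \<psi>bar \<psi>"
proof -
  have lie: "lie_group G \<G>"
    using \<open>compact_lie_group G \<G>\<close> by (simp add: compact_lie_group_def)
  \<comment> \<open>Continuity includes that \<open>U\<close> maps into the topspace of
    \<open>mtop \<G>\<close>, which is \<open>carrier G\<close>.\<close>
  have "continuous_map (top_of_set Meff) (mtop \<G>) U"
    using \<open>smooth_map (region W Meff) \<G> U\<close> by (simp add: smooth_map_def region_def)
  then have U: "U x \<in> carrier G" if "x \<in> Meff" for x
    using lie that by (auto simp: lie_group_def continuous_map_def)
  have inverse: "Rinv x ** R x = mat 1" if "x \<in> Meff" for x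
    using lie_representation_left_inverse[OF lie \<open>lie_representation G \<G> \<rho>\<close> U[OF that]]
    by (simp add: R_def Rinv_def)
  have cancel: "gauge_fermion Rinv (gauge_fermion R \<psi>) x = \<psi> x" if "x \<in> Meff" for x
    using inverse[OF that] by (simp add: gauge_fermion_def gauge_act_compose)
  have cov: "D a (gauge_fermion Rinv (gauge_fermion R \<psi>)) x = D a \<psi> x"
    if "a \<in> E" "x \<in> Meff" for a x
    unfolding D_def using that cancel \<open>open M\<close>
    by (intro deformed_covariant_derivative_cong_eff_sector) (auto simp: E_def Meff_def)
  have integrand:
    "dual_pairing (gauge_dual_fermion \<psi>bar Rinv x)
       ((\<Sum>a\<in>E. cscale \<i> (\<gamma> a ** gauge_fermion R (D a (gauge_fermion Rinv (gauge_fermion R \<psi>))) x))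
         - cscale (complex_of_real m) (gauge_fermion R \<psi> x))
     = dual_pairing (\<psi>bar x)
       ((\<Sum>a\<in>E. cscale \<i> (\<gamma> a ** D a \<psi> x)) - cscale (complex_of_real m) (\<psi> x))"
    (is "dual_pairing _ ?lhs = dual_pairing _ ?rhs")
    if "x \<in> Meff" for x
  proof -
    \<comment> \<open>After \<open>cov\<close>, every summand and the mass term carry
      \<open>R x\<close>, which linearity pulls out of the bracket.\<close>
    have "?lhs = gauge_act (R x) ?rhs"
      using that
      by (simp add: gauge_fermion_def[where T = R] cov spinor_matrix_gauge_act gauge_act_diff
          gauge_act_sum gauge_act_cscale)
    then show ?thesis
      using inverse[OF that]
      by (simp add: gauge_dual_fermion_def dual_pairing_gauge_act_dual gauge_act_compose)
  qed
  have Meff_eq: "Meff = eff_sector M E p"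
    by (simp add: Meff_def E_def)
  \<comment> \<open>Measure and volume density are the same on both sides since the metric is a
    fixed background. Off \<open>Meff\<close> the indicator makes both integrands zero, so
    \<open>integrand\<close> on \<open>Meff\<close> suffices.\<close>
  show ?thesis
    unfolding fermionic_action_def Let_def set_lebesgue_integral_def
      E_def[symmetric] Meff_eq[symmetric]
    by (intro Bochner_Integration.integral_cong refl) (auto simp: integrand indicator_def)
qed

end
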